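(* Let $\mathbb{F}$ be an algebraically closed field of characteristic zero, let $j$ be a positive integer, and let $$f=\sum_{i=1}^m\frac{\alpha_{i,j}}{(y-\beta_i)^j}\in\overline{\mathbb{F}(x)}(y),$$ with $\alpha_{i,j},\beta_i\in\overline{\mathbb{F}(x)}$, $\alpha_{i,j}\neq0$, and such that for all $i,i'$ with $1\le i<i'\le m$ one has $\beta_i-\sigma_x^n(\beta_{i'})\notin\mathbb{Z}$ for every $n\in\mathbb{Z}$. Then $f$ is $(\sigma_x,\sigma_y)$-summable in $\overline{\mathbb{F}(x)}(y)$ if and only if for each $i\in\{1,\dots,m\}$ we have $\beta_i=\frac{s_i}{t_i}x+c_i$ with $s_i\in\mathbb{Z}$, $t_i\in\mathbb{N}\setminus\{0\}$, $c_i\in\mathbb{F}$, and $\alpha_{i,j}=\sigma_x^{t_i}(\gamma_i)-\gamma_i$ for some $\gamma_i\in\mathbb{F}(x)$.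
   Context: $\sigma_x$ and $\sigma_y$ are the shift operators $\sigma_x(f(x,y))=f(x+1,y)$, $\sigma_y(f(x,y))=f(x,y+1)$ on $\mathbb{F}(x,y)$, extended to automorphisms of $\overline{\mathbb{F}(x,y)}$; on $\overline{\mathbb{F}(x)}(y)$, $\sigma_x$ acts on the coefficients in $\overline{\mathbb{F}(x)}$ and fixes $y$, and $\sigma_y$ fixes $\overline{\mathbb{F}(x)}$ and maps $y\mapsto y+1$. An element $f$ is $(\sigma_x,\sigma_y)$-summable in $\overline{\mathbb{F}(x)}(y)$ if $f=\sigma_x(g)-g+\sigma_y(h)-h$ for some $g,h\in\overline{\mathbb{F}(x)}(y)$.
   Formalization: The witnesses γ_i are required only to lie in the algebraic closure of F(x), and in F(x) whenever α_{i,j} is in F(x); requiring γ_i in F(x) always is false (m=j=1, β_1=0, α=σ_x(r)−r with r²=x). *)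

theory Defs
  imports
    "HOL-Computational_Algebra.Computational_Algebra"
    "HOL-Algebra.Algebraic_Closure_Type"
begin

text \<open>
  The field \<open>F\<close> is a type \<open>'a\<close>; \<open>F(x)\<close> is \<open>'a poly fract\<close>, its algebraic closure \<open>K\<close> is
  \<open>'a poly fract alg_closure\<close> with embedding \<^const>\<open>to_ac\<close>, and \<open>K(y)\<close> is \<open>K poly fract\<close>.
\<close>

type_synonym 'a rat_closure = "'a poly fract alg_closure"

text \<open>
  The map on fractions induced by an injective ring homomorphism \<open>\<phi>\<close>; the description is
  meaningful only for such \<open>\<phi>\<close>, see \<open>map_fract_Fract\<close>.
\<close>

definition map_fract :: "('a::idom \<Rightarrow> 'b::idom) \<Rightarrow> 'a fract \<Rightarrow> 'b fract" where
  "map_fract \<phi> q = (THE r. \<exists>a b. b \<noteq> 0 \<and> q = Fract a b \<and> r = Fract (\<phi> a) (\<phi> b))"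

lemma map_fract_Fract:
  assumes mult: "\<And>a b. \<phi> (a * b) = \<phi> a * \<phi> b"
    and nz: "\<And>a. \<phi> a = 0 \<longleftrightarrow> a = 0" and "b \<noteq> 0"
  shows "map_fract \<phi> (Fract a b) = Fract (\<phi> a) (\<phi> b)"
  unfolding map_fract_def
proof (rule the_equality)
  show "\<exists>a' b'. b' \<noteq> 0 \<and> Fract a b = Fract a' b' \<and> Fract (\<phi> a) (\<phi> b) = Fract (\<phi> a') (\<phi> b')"
    using \<open>b \<noteq> 0\<close> by blast
next
  fix r
  assume "\<exists>a' b'. b' \<noteq> 0 \<and> Fract a b = Fract a' b' \<and> r = Fract (\<phi> a') (\<phi> b')"
  then obtain a' b' where *: "b' \<noteq> 0" "Fract a b = Fract a' b'" "r = Fract (\<phi> a') (\<phi> b')"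
    by blast
  then have "a * b' = a' * b"
    using \<open>b \<noteq> 0\<close> by (simp add: eq_fract)
  then have "\<phi> a * \<phi> b' = \<phi> a' * \<phi> b"
    by (metis mult)
  then show "r = Fract (\<phi> a) (\<phi> b)"
    using * \<open>b \<noteq> 0\<close> nz by (simp add: eq_fract)
qed

text \<open>
  The shift of the indeterminate by 1 in a rational function field: this is \<open>\<sigma>\<^sub>x\<close> on \<open>F(x)\<close>, and
  \<open>\<sigma>\<^sub>y\<close> on \<open>K(y)\<close>.
\<close>

definition shift_var :: "'k::field poly fract \<Rightarrow> 'k poly fract" where
  "shift_var = map_fract (\<lambda>p. pcompose p [:1, 1:])"

text \<open>The action of an automorphism of \<open>K\<close> on \<open>K(y)\<close> through the coefficients, fixing \<open>y\<close>.\<close>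

definition map_coeffs :: "('k::field \<Rightarrow> 'k) \<Rightarrow> 'k poly fract \<Rightarrow> 'k poly fract" where
  "map_coeffs \<sigma> = map_fract (map_poly \<sigma>)"

text \<open>
  The extension of \<open>\<sigma>\<^sub>x\<close> from \<open>F(x)\<close> to its algebraic closure is not unique; results are stated for
  every automorphism extending it.
\<close>

definition extends_shift :: "('a::field rat_closure \<Rightarrow> 'a rat_closure) \<Rightarrow> bool" where
  "extends_shift \<sigma> \<longleftrightarrow> bij \<sigma> \<and> (\<forall>u v. \<sigma> (u + v) = \<sigma> u + \<sigma> v) \<and> (\<forall>u v. \<sigma> (u * v) = \<sigma> u * \<sigma> v) \<and>
     (\<forall>r. \<sigma> (to_ac r) = to_ac (shift_var r))"

definition int_iterate :: "('k \<Rightarrow> 'k) \<Rightarrow> int \<Rightarrow> 'k \<Rightarrow> 'k" where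
  "int_iterate \<sigma> n = (if n \<ge> 0 then \<sigma> ^^ nat n else inv_into UNIV \<sigma> ^^ nat (- n))"

text \<open>
  Since \<open>g\<close> and \<open>h\<close> have coefficients in \<open>K\<close>, a term \<open>(\<sigma> \<gamma> - \<gamma>) / y ^ j\<close> is summable for every
  \<open>\<gamma>\<close> in \<open>K\<close>, also when \<open>\<sigma> \<gamma> - \<gamma>\<close> lies outside \<open>F(x)\<close> (for instance for \<open>\<gamma>\<^sup>2 = x\<close>).  A
  summability criterion can therefore ask for a witness \<open>\<gamma>\<close> in \<open>F(x)\<close> only for numerators in \<open>F(x)\<close>.
\<close>

definition xy_summable :: "('k::field \<Rightarrow> 'k) \<Rightarrow> 'k poly fract \<Rightarrow> bool" where
  "xy_summable \<sigma> f \<longleftrightarrow> (\<exists>g h. f = map_coeffs \<sigma> g - g + (shift_var h - h))"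

definition var_x :: "'a::field rat_closure" where
  "var_x = to_ac (to_fract [:0, 1:])"

definition const_x :: "'a::field \<Rightarrow> 'a rat_closure" where
  "const_x c = to_ac (to_fract [:c:])"

definition var_y :: "'k::field poly fract" where
  "var_y = to_fract [:0, 1:]"

definition const_y :: "'k::field \<Rightarrow> 'k poly fract" where
  "const_y u = to_fract [:u:]"

end

theory Submission
  imports Defs "HOL-Library.Groups_Big_Fun"
begin

text \<open>
  The discrete residue of \<open>q\<close> at \<open>b\<close> in order \<open>j\<close> is the sum over \<open>n \<in> \<int>\<close> of the coefficients of
  \<open>(y - b - n)\<^sup>-\<^sup>j\<close> in the partial fraction expansion of \<open>q\<close>. It annihilates \<open>\<sigma>\<^sub>y h - h\<close> and commutes
  with \<open>\<sigma>\<^sub>x\<close>, so if \<open>f\<close> is summable through \<open>g\<close> and \<open>h\<close>, the residues \<open>r\<close> of \<open>g\<close> satisfy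
  \<open>res f (\<sigma> b) = \<sigma> (r b) - r (\<sigma> b)\<close>. On the \<open>\<sigma>\<close>-orbit of \<open>\<beta>\<^sub>i\<close> modulo \<open>\<int>\<close>, the residue of \<open>f\<close> is
  \<open>\<alpha>\<^sub>i\<close> at \<open>\<beta>\<^sub>i\<close> and vanishes elsewhere. On an infinite orbit, finiteness of the set of poles of \<open>g\<close>
  would force \<open>\<alpha>\<^sub>i = 0\<close>; on an orbit of length \<open>t\<close>, telescoping gives \<open>\<alpha>\<^sub>i = \<sigma>\<^sup>t \<gamma> - \<gamma>\<close> for \<open>\<gamma> = r \<beta>\<^sub>i\<close>.
  Periodicity \<open>\<sigma>\<^sup>t \<beta>\<^sub>i = \<beta>\<^sub>i + s\<close> means that \<open>\<beta>\<^sub>i - (s/t) x\<close> is fixed by \<open>\<sigma>\<^sup>t\<close>, hence its minimal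
  polynomial has constant coefficients. Finally, if \<open>\<alpha>\<^sub>i\<close> is in \<open>F(x)\<close>, then \<open>\<gamma>\<close> can be replaced by its
  normalised trace over \<open>F(x)\<close>, which is read off the minimal polynomial of \<open>\<gamma>\<close>.
\<close>

section \<open>Injective ring homomorphisms\<close>

text \<open>One interface for the shifts, coefficient actions, constant embeddings, and Taylor and
  Laurent expansions below. Vanishing only at 0 is the form of injectivity that passes directly to
  fractions.\<close>

locale inj_idom_hom =
  fixes \<phi> :: "'a::idom \<Rightarrow> 'b::idom"
  assumes add: "\<phi> (u + v) = \<phi> u + \<phi> v"
    and mult: "\<phi> (u * v) = \<phi> u * \<phi> v"
    and eq_0_iff [simp]: "\<phi> u = 0 \<longleftrightarrow> u = 0"
begin

lemma zero [simp]: "\<phi> 0 = 0"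
  by simp

lemma one [simp]: "\<phi> 1 = 1"
  using mult[of 1 1] by simp

lemma uminus: "\<phi> (- u) = - \<phi> u"
  using add[of u "- u"] by (simp add: eq_neg_iff_add_eq_0 add.commute)

lemma diff: "\<phi> (u - v) = \<phi> u - \<phi> v"
  using add[of u "- v"] by (simp add: uminus)

lemma inj: "inj \<phi>"
proof (rule injI)
  fix u v
  assume "\<phi> u = \<phi> v"
  then have "\<phi> (u - v) = 0"
    by (simp add: diff)
  then show "u = v"
    by simp
qed

lemma power: "\<phi> (u ^ n) = \<phi> u ^ n"
  by (induction n) (simp_all add: mult)

lemma sum: "\<phi> (sum f A) = (\<Sum>x\<in>A. \<phi> (f x))"
  by (induction A rule: infinite_finite_induct) (simp_all add: add)

lemma of_nat: "\<phi> (of_nat n) = of_nat n"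
  by (induction n) (simp_all add: add)

lemma of_int: "\<phi> (of_int n) = of_int n"
  by (cases n rule: int_cases2) (simp_all add: of_nat uminus)


lemma map_poly_hom: "inj_idom_hom (map_poly \<phi>)"
proof
  show "map_poly \<phi> (p + q) = map_poly \<phi> p + map_poly \<phi> q" for p q
    by (rule poly_eqI) (simp add: coeff_map_poly add)
  show "map_poly \<phi> (p * q) = map_poly \<phi> p * map_poly \<phi> q" for p q
    by (rule poly_eqI) (simp add: coeff_map_poly coeff_mult sum mult)
  show "map_poly \<phi> p = 0 \<longleftrightarrow> p = 0" for p
    by (simp add: poly_eq_iff coeff_map_poly)
qed

lemma poly_map_poly: "poly (map_poly \<phi> p) (\<phi> u) = \<phi> (poly p u)"
  by (induction p) (simp_all add: map_poly_pCons add mult)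

lemma map_fract: "b \<noteq> 0 \<Longrightarrow> map_fract \<phi> (Fract a b) = Fract (\<phi> a) (\<phi> b)"
  by (rule map_fract_Fract) (auto simp: mult)

lemma map_fract_hom: "inj_idom_hom (map_fract \<phi>)"
proof
  show "map_fract \<phi> (p + q) = map_fract \<phi> p + map_fract \<phi> q" for p q
    by (cases p, cases q) (simp add: map_fract add mult)
  show "map_fract \<phi> (p * q) = map_fract \<phi> p * map_fract \<phi> q" for p q
    by (cases p, cases q) (simp add: map_fract mult)
  show "map_fract \<phi> p = 0 \<longleftrightarrow> p = 0" for p
    by (cases p) (simp add: map_fract Zero_fract_def eq_fract)
qed

end

lemma inj_idom_hom_comp:
  assumes "inj_idom_hom \<phi>" "inj_idom_hom \<psi>"
  shows "inj_idom_hom (\<lambda>x. \<phi> (\<psi> x))"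
proof -
  interpret \<phi>: inj_idom_hom \<phi> by fact
  interpret \<psi>: inj_idom_hom \<psi> by fact
  show ?thesis
    by standard (simp_all add: \<phi>.add \<psi>.add \<phi>.mult \<psi>.mult)
qed

lemma inj_idom_hom_funpow:
  fixes \<phi> :: "'a::idom \<Rightarrow> 'a"
  assumes "inj_idom_hom \<phi>"
  shows "inj_idom_hom (\<phi> ^^ n)"
proof (induction n)
  case 0
  show ?case by standard auto
next
  case (Suc n)
  show ?case using inj_idom_hom_comp[OF assms Suc] by (simp add: o_def)
qed

lemma inj_idom_hom_divide:
  fixes \<phi> :: "'a::field \<Rightarrow> 'b::field"
  assumes "inj_idom_hom \<phi>"
  shows "\<phi> (u / v) = \<phi> u / \<phi> v"
proof -
  interpret inj_idom_hom \<phi> by fact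
  show ?thesis
  proof (cases "v = 0")
    case False
    then have "\<phi> u = \<phi> (u / v) * \<phi> v"
      by (simp flip: mult)
    then show ?thesis
      using False by (simp add: eq_divide_eq)
  qed simp
qed

lemma inj_idom_hom_to_fract: "inj_idom_hom to_fract"
  by standard auto

lemma inj_idom_hom_to_ac: "inj_idom_hom to_ac"
  by standard auto

lemma inj_idom_hom_const_poly: "inj_idom_hom (\<lambda>c. [:c:])"
  by standard auto

lemma inj_idom_hom_translate: "inj_idom_hom (\<lambda>p. pcompose p [:c, 1:])"
proof
  show "pcompose p [:c, 1:] = 0 \<longleftrightarrow> p = 0" for p :: "'a poly"
    by (rule pcompose_eq_0_iff) simp
qed (simp_all add: pcompose_add pcompose_mult)

lemma inj_idom_hom_shift_var: "inj_idom_hom shift_var"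
  unfolding shift_var_def by (intro inj_idom_hom.map_fract_hom inj_idom_hom_translate)

lemma inj_idom_hom_map_coeffs: "inj_idom_hom \<sigma> \<Longrightarrow> inj_idom_hom (map_coeffs \<sigma>)"
  unfolding map_coeffs_def by (intro inj_idom_hom.map_fract_hom inj_idom_hom.map_poly_hom)

lemma inj_idom_hom_const_x: "inj_idom_hom const_x"
  unfolding const_x_def
  by (intro inj_idom_hom_comp[OF inj_idom_hom_to_ac] inj_idom_hom_comp[OF inj_idom_hom_to_fract]
      inj_idom_hom_const_poly)

section \<open>Polar coefficients of a rational function\<close>

text \<open>Extension of an embedding into a field to the fraction field, with values in that field
  itself; \<open>map_fract\<close> would land in its fractions.\<close>

definition lift_fract :: "('a::idom \<Rightarrow> 'b::field) \<Rightarrow> 'a fract \<Rightarrow> 'b" where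
  "lift_fract \<phi> q = (THE r. \<exists>a b. b \<noteq> 0 \<and> q = Fract a b \<and> r = \<phi> a / \<phi> b)"

lemma lift_fract_Fract:
  assumes "inj_idom_hom \<phi>" "b \<noteq> 0"
  shows "lift_fract \<phi> (Fract a b) = \<phi> a / \<phi> b"
proof -
  interpret inj_idom_hom \<phi> by fact
  show ?thesis
    unfolding lift_fract_def
  proof (rule the_equality)
    fix r
    assume "\<exists>a' b'. b' \<noteq> 0 \<and> Fract a b = Fract a' b' \<and> r = \<phi> a' / \<phi> b'"
    then obtain a' b' where *: "b' \<noteq> 0" "Fract a b = Fract a' b'" "r = \<phi> a' / \<phi> b'"
      by blast
    then have "a * b' = a' * b"
      using \<open>b \<noteq> 0\<close> by (simp add: eq_fract)
    then have "\<phi> a * \<phi> b' = \<phi> a' * \<phi> b"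
      by (metis mult)
    then show "r = \<phi> a / \<phi> b"
      using * \<open>b \<noteq> 0\<close> by (simp add: frac_eq_eq)
  qed (use \<open>b \<noteq> 0\<close> in blast)
qed

lemma inj_idom_hom_lift_fract:
  assumes "inj_idom_hom \<phi>"
  shows "inj_idom_hom (lift_fract \<phi>)"
proof -
  interpret inj_idom_hom \<phi> by fact
  note lift = lift_fract_Fract[OF assms]
  show ?thesis
  proof
    show "lift_fract \<phi> (p + q) = lift_fract \<phi> p + lift_fract \<phi> q" for p q
      by (cases p, cases q) (simp add: lift add mult add_frac_eq)
    show "lift_fract \<phi> (p * q) = lift_fract \<phi> p * lift_fract \<phi> q" for p q
      by (cases p, cases q) (simp add: lift mult)
    show "lift_fract \<phi> p = 0 \<longleftrightarrow> p = 0" for p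
      by (cases p) (simp add: lift Zero_fract_def eq_fract)
  qed
qed

text \<open>Expansion in the local parameter \<open>y - b\<close>, taken directly in Laurent series
  so that it can be divided.\<close>

definition taylor :: "'k::field \<Rightarrow> 'k poly \<Rightarrow> 'k fls" where
  "taylor b p = fps_to_fls (fps_of_poly (pcompose p [:b, 1:]))"

definition laurent :: "'k::field \<Rightarrow> 'k poly fract \<Rightarrow> 'k fls" where
  "laurent b = lift_fract (taylor b)"

definition polar_coeff :: "nat \<Rightarrow> 'k::field poly fract \<Rightarrow> 'k \<Rightarrow> 'k" where
  "polar_coeff j q b = fls_nth (laurent b q) (- int j)"

lemma inj_idom_hom_taylor: "inj_idom_hom (taylor b)"
proof
  show "taylor b p = 0 \<longleftrightarrow> p = 0" for p
    unfolding taylor_def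
    by (metis fps_of_poly_0 fps_of_poly_eq_iff fps_to_fls_eq_0_iff
        inj_idom_hom.eq_0_iff[OF inj_idom_hom_translate])
qed (simp_all add: taylor_def pcompose_add pcompose_mult fps_of_poly_add fps_of_poly_mult
    fls_times_fps_to_fls)

lemma laurent_Fract: "r \<noteq> 0 \<Longrightarrow> laurent b (Fract p r) = taylor b p / taylor b r"
  unfolding laurent_def by (intro lift_fract_Fract inj_idom_hom_taylor)

lemma inj_idom_hom_laurent: "inj_idom_hom (laurent b)"
  unfolding laurent_def by (intro inj_idom_hom_lift_fract inj_idom_hom_taylor)

lemma polar_coeff_add: "polar_coeff j (p + q) b = polar_coeff j p b + polar_coeff j q b"
  by (simp add: polar_coeff_def inj_idom_hom.add[OF inj_idom_hom_laurent])

lemma taylor_translate: "taylor b (pcompose p [:1, 1:]) = taylor (b + 1) p"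
  by (simp add: taylor_def pcompose_pCons add.commute flip: pcompose_assoc)

lemma polar_coeff_shift_var: "polar_coeff j (shift_var q) b = polar_coeff j q (b + 1)"
proof (cases q)
  case (Fract p r)
  interpret inj_idom_hom "\<lambda>p::'a poly. pcompose p [:1, 1:]"
    by (rule inj_idom_hom_translate)
  show ?thesis
    using Fract by (simp add: polar_coeff_def shift_var_def map_fract laurent_Fract taylor_translate)
qed

text \<open>The denominator is a unit among power series in \<open>y - b\<close>, so the quotient
  has no negative powers.\<close>

lemma polar_coeff_Fract_eq_0:
  assumes "j > 0" "poly r b \<noteq> 0"
  shows "polar_coeff j (Fract p r) b = 0"
proof -
  let ?P = "fps_of_poly (pcompose p [:b, 1:])" and ?R = "fps_of_poly (pcompose r [:b, 1:])"
  have "fps_nth ?R 0 \<noteq> 0"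
    using assms by (simp add: poly_0_coeff_0[symmetric] poly_pcompose)
  then have "?P = ?P / ?R * ?R"
    by (simp add: fps_divide_unit mult.assoc inverse_mult_eq_1)
  then have "taylor b p = fps_to_fls (?P / ?R) * taylor b r"
    by (metis fls_times_fps_to_fls taylor_def)
  moreover have "taylor b r \<noteq> 0" "r \<noteq> 0"
    using assms by (auto simp: inj_idom_hom.eq_0_iff[OF inj_idom_hom_taylor])
  ultimately have "laurent b (Fract p r) = fps_to_fls (?P / ?R)"
    by (simp add: laurent_Fract)
  then show ?thesis
    using assms by (simp add: polar_coeff_def)
qed

lemma finite_polar_coeff:
  assumes "j > 0"
  shows "finite {b. polar_coeff j q b \<noteq> 0}"
proof (cases q)
  case (Fract p r)
  have "{b. polar_coeff j q b \<noteq> 0} \<subseteq> {b. poly r b = 0}"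
    using Fract assms polar_coeff_Fract_eq_0 by blast
  then show ?thesis
    using poly_roots_finite[OF \<open>r \<noteq> 0\<close>] finite_subset by blast
qed

definition pole :: "nat \<Rightarrow> 'k::field \<Rightarrow> 'k \<Rightarrow> 'k poly fract" where
  "pole j \<alpha> \<beta> = const_y \<alpha> / (var_y - const_y \<beta>) ^ j"

lemma pole_conv_Fract: "pole j \<alpha> \<beta> = Fract [:\<alpha>:] ([:-\<beta>, 1:] ^ j)"
proof -
  have "var_y - const_y \<beta> = to_fract [:-\<beta>, 1:]"
    by (simp add: var_y_def const_y_def flip: to_fract_diff)
  then show ?thesis
    by (simp add: pole_def const_y_def Fract_conv_to_fract
        inj_idom_hom.power[OF inj_idom_hom_to_fract])
qed

lemma polar_coeff_pole:
  assumes "j > 0"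
  shows "polar_coeff j (pole j \<alpha> \<beta>) b = (if b = \<beta> then \<alpha> else 0)"
proof (cases "b = \<beta>")
  case True
  have "taylor b [:-\<beta>, 1:] = fls_X" "taylor b [:\<alpha>:] = fls_const \<alpha>"
    using True by (simp_all add: taylor_def pcompose_pCons fps_of_poly_const)
  then have "laurent b (pole j \<alpha> \<beta>) = fls_const \<alpha> / fls_X ^ j"
    by (simp add: pole_conv_Fract laurent_Fract inj_idom_hom.power[OF inj_idom_hom_taylor])
  then show ?thesis
    using True by (simp add: polar_coeff_def)
next
  case False
  then show ?thesis
    using assms by (simp add: pole_conv_Fract polar_coeff_Fract_eq_0)
qed

text \<open>Without the guard, a map with \<open>\<phi> 0 \<noteq> 0\<close> would destroy
  boundedness below of the support.\<close>

lift_definition map_fls :: "('a::zero \<Rightarrow> 'b::zero) \<Rightarrow> 'a fls \<Rightarrow> 'b fls"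
  is "\<lambda>\<phi> f n. if \<phi> 0 = 0 then \<phi> (f n) else 0"
  by (auto elim!: eventually_mono simp del: MOST_iff_cofinite)

lemma map_fls_nth: "\<phi> 0 = 0 \<Longrightarrow> fls_nth (map_fls \<phi> f) n = \<phi> (fls_nth f n)"
  by transfer simp

text \<open>Injectivity keeps the subdegree, so both convolution sums run over the same index
  range.\<close>

lemma map_fls_times:
  assumes "inj_idom_hom \<phi>"
  shows "map_fls \<phi> (f * g) = map_fls \<phi> f * map_fls \<phi> g"
proof -
  interpret inj_idom_hom \<phi> by fact
  have sub: "fls_subdegree (map_fls \<phi> f) = fls_subdegree f" for f
  proof (cases "f = 0")
    case True
    then have "map_fls \<phi> f = 0"
      by (intro fls_eqI) (simp add: map_fls_nth)
    then show ?thesis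
      using True by simp
  next
    case False
    then show ?thesis
      by (intro fls_subdegree_eqI) (simp_all add: map_fls_nth)
  qed
  show ?thesis
    by (rule fls_eqI) (simp add: map_fls_nth fls_times_nth(1) sub sum mult)
qed

lemma map_poly_translate:
  assumes "inj_idom_hom \<sigma>"
  shows "map_poly \<sigma> (pcompose p [:b, 1:]) = pcompose (map_poly \<sigma> p) [:\<sigma> b, 1:]"
proof -
  interpret inj_idom_hom \<sigma> by fact
  interpret P: inj_idom_hom "map_poly \<sigma>" by (rule map_poly_hom)
  show ?thesis
    by (induction p) (simp_all add: pcompose_pCons map_poly_pCons P.add P.mult map_poly_smult mult)
qed

lemma polar_coeff_map_coeffs:
  assumes "inj_idom_hom \<sigma>"
  shows "polar_coeff j (map_coeffs \<sigma> q) (\<sigma> b) = \<sigma> (polar_coeff j q b)"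
proof (cases q)
  case (Fract p r)
  interpret inj_idom_hom \<sigma> by fact
  interpret P: inj_idom_hom "map_poly \<sigma>" by (rule map_poly_hom)
  have taylor: "taylor (\<sigma> b) (map_poly \<sigma> p) = map_fls \<sigma> (taylor b p)" for p
    unfolding taylor_def map_poly_translate[OF assms, symmetric]
    by (rule fls_eqI) (simp add: map_fls_nth coeff_map_poly)
  have nz: "taylor c p \<noteq> 0" if "p \<noteq> 0" for c :: 'a and p
    using that by (simp add: inj_idom_hom.eq_0_iff[OF inj_idom_hom_taylor])
  \<comment> \<open>Clearing the denominator replaces division of Laurent series by
    \<open>map_fls_times\<close>.\<close>
  have "taylor b p = laurent b q * taylor b r"
    using Fract nz by (simp add: laurent_Fract)
  then have "taylor (\<sigma> b) (map_poly \<sigma> p) = map_fls \<sigma> (laurent b q) * taylor (\<sigma> b) (map_poly \<sigma> r)"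
    by (metis taylor map_fls_times[OF assms])
  then have "laurent (\<sigma> b) (map_coeffs \<sigma> q) = map_fls \<sigma> (laurent b q)"
    using Fract nz by (simp add: map_coeffs_def P.map_fract laurent_Fract)
  then show ?thesis
    by (simp add: polar_coeff_def map_fls_nth)
qed

section \<open>Discrete residues\<close>

text \<open>The sum over all integers is a \<open>Sum_any\<close>, which defaults to 0 on infinite
  support; characteristic zero and \<open>j > 0\<close> make the support finite, see
  \<open>finite_polar_coeff_int\<close>.\<close>

definition residue :: "nat \<Rightarrow> 'k::field_char_0 poly fract \<Rightarrow> 'k \<Rightarrow> 'k" where
  "residue j q b = (\<Sum>n. polar_coeff j q (b + of_int n))"

lemma inj_add_of_int: "inj (\<lambda>n. (b::'k::field_char_0) + of_int n)"
  by (auto intro: injI)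

lemma finite_polar_coeff_int:
  assumes "j > 0"
  shows "finite {n. polar_coeff j q ((b::'k::field_char_0) + of_int n) \<noteq> 0}"
  using finite_vimageI[OF finite_polar_coeff[OF assms, of q] inj_add_of_int, of b]
  by (simp add: vimage_def)

lemma residue_add:
  assumes "j > 0"
  shows "residue j (p + q) b = residue j p b + residue j q b"
  unfolding residue_def polar_coeff_add
  by (intro Sum_any.distrib finite_polar_coeff_int assms)

lemma residue_diff:
  assumes "j > 0"
  shows "residue j (p - q) b = residue j p b - residue j q b"
  using residue_add[OF assms, of "p - q" q] by simp

lemma residue_sum:
  assumes "j > 0"
  shows "residue j (\<Sum>i\<in>A. f i) b = (\<Sum>i\<in>A. residue j (f i) b)"
proof (induction A rule: infinite_finite_induct)
  case empty
  show ?case using residue_diff[OF assms, of 0 0] by simp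
next
  case (infinite A)
  then show ?case using residue_diff[OF assms, of 0 0] by simp
qed (simp_all add: residue_add assms)

lemma residue_of_int: "residue j q (b + of_int n) = residue j q b"
  unfolding residue_def
  by (rule Sum_any.reindex_cong[where l = "\<lambda>m. m + n", symmetric])
    (auto intro!: o_bij[where g = "\<lambda>m. m - n"] simp: algebra_simps)

text \<open>Moving the base point by 1 only reindexes the sum; hence \<open>shift_var h - h\<close>
  leaves no residue when \<open>j > 0\<close>.\<close>

lemma residue_shift_var: "residue j (shift_var q) b = residue j q b"
  using residue_of_int[of j q b 1]
  by (simp add: residue_def polar_coeff_shift_var add_ac)

lemma residue_map_coeffs:
  assumes "inj_idom_hom \<sigma>" "j > 0"
  shows "residue j (map_coeffs \<sigma> q) (\<sigma> b) = \<sigma> (residue j q b)"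
proof -
  interpret inj_idom_hom \<sigma> by fact
  have "polar_coeff j (map_coeffs \<sigma> q) (\<sigma> b + of_int n) = \<sigma> (polar_coeff j q (b + of_int n))" for n
    using polar_coeff_map_coeffs[OF assms(1), of j q "b + of_int n"] by (simp add: add of_int)
  then show ?thesis
    by (simp add: residue_def Sum_any.expand_set sum)
qed

lemma residue_pole:
  assumes "j > 0"
  shows "residue j (pole j \<alpha> \<beta>) b = (if b - \<beta> \<in> \<int> then \<alpha> else 0)"
proof (cases "b - \<beta> \<in> \<int>")
  case True
  then obtain m where "b - \<beta> = of_int m"
    by (auto elim: Ints_cases)
  then have "b = \<beta> + of_int m"
    by (simp add: algebra_simps)
  \<comment> \<open>With base point \<open>\<beta>\<close> only the summand for 0 survives.\<close>
  then have "residue j (pole j \<alpha> \<beta>) b = residue j (pole j \<alpha> \<beta>) \<beta>"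
    by (simp only: residue_of_int)
  also have "\<dots> = (\<Sum>n\<in>{0::int}. \<alpha>)"
    unfolding residue_def
    by (subst Sum_any.expand_superset[of "{0}"]) (auto simp: polar_coeff_pole assms split: if_splits)
  finally show ?thesis
    using True by simp
next
  case False
  have "b + of_int n \<noteq> \<beta>" for n
  proof
    assume "b + of_int n = \<beta>"
    then have "b - \<beta> = of_int (- n)"
      by (auto simp: algebra_simps)
    then show False
      using False by (metis Ints_of_int)
  qed
  then show ?thesis
    using False by (simp add: residue_def polar_coeff_pole assms)
qed

text \<open>Nonzero residues throughout would give a pole of \<open>q\<close> in each of infinitely
  many distinct classes modulo \<int>.\<close>

lemma residue_eventually_0:
  fixes b :: "nat \<Rightarrow> 'k::field_char_0"
  assumes "j > 0" and incong: "\<And>k l. k \<noteq> l \<Longrightarrow> b k - b l \<notin> \<int>"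
  obtains k where "residue j q (b k) = 0"
proof -
  have False if nz: "\<And>k. residue j q (b k) \<noteq> 0"
  proof -
    have "\<exists>n. polar_coeff j q (b k + of_int n) \<noteq> 0" for k
      using nz[of k] by (metis residue_def Sum_any.not_neutral_obtains_not_neutral)
    then obtain n where n: "\<And>k. polar_coeff j q (b k + of_int (n k)) \<noteq> 0"
      by metis
    have "inj (\<lambda>k. b k + of_int (n k))"
    proof (rule injI, rule ccontr)
      fix k l
      assume "b k + of_int (n k) = b l + of_int (n l)" "k \<noteq> l"
      then have "b k - b l = of_int (n l - n k)"
        by (simp add: algebra_simps)
      then show False
        using incong[OF \<open>k \<noteq> l\<close>] by (metis Ints_of_int)
    qed
    moreover have "range (\<lambda>k. b k + of_int (n k)) \<subseteq> {b. polar_coeff j q b \<noteq> 0}"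
      using n by auto
    ultimately show False
      using finite_polar_coeff[OF \<open>j > 0\<close>, of q] by (meson finite_imageD finite_subset infinite_UNIV_nat)
  qed
  then show thesis
    using that by blast
qed

section \<open>Orbits of the shift\<close>

lemma diff_in_Ints_commute: "u - v \<in> \<int> \<Longrightarrow> v - u \<in> \<int>"
  by (metis Ints_minus minus_diff_eq)

locale field_aut = inj_idom_hom \<sigma> for \<sigma> :: "'k::field_char_0 \<Rightarrow> 'k" +
  assumes surj: "surj \<sigma>"
begin

text \<open>The inverse in the form in which \<open>int_iterate\<close> uses it.\<close>

abbreviation \<tau> :: "'k \<Rightarrow> 'k" where "\<tau> \<equiv> inv_into UNIV \<sigma>"

lemma \<sigma>_\<tau> [simp]: "\<sigma> (\<tau> u) = u"
  by (rule surj_f_inv_f[OF surj])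

lemma \<tau>_\<sigma> [simp]: "\<tau> (\<sigma> u) = u"
  by (rule inv_f_f[OF inj])

lemma funpow_\<sigma>_\<tau> [simp]: "(\<sigma> ^^ k) ((\<tau> ^^ k) u) = u"
  by (induction k arbitrary: u) (simp_all add: funpow_swap1)

lemma funpow_\<tau>_\<sigma> [simp]: "(\<tau> ^^ k) ((\<sigma> ^^ k) u) = u"
  by (induction k arbitrary: u) (simp_all add: funpow_swap1)

lemma funpow_hom: "inj_idom_hom (\<sigma> ^^ k)"
  by (rule inj_idom_hom_funpow) (rule inj_idom_hom_axioms)

lemma inverse_hom: "inj_idom_hom \<tau>"
proof
  show "\<tau> (u + v) = \<tau> u + \<tau> v" for u v
    by (metis \<sigma>_\<tau> \<tau>_\<sigma> add)
  show "\<tau> (u * v) = \<tau> u * \<tau> v" for u v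
    by (metis \<sigma>_\<tau> \<tau>_\<sigma> mult)
  show "\<tau> u = 0 \<longleftrightarrow> u = 0" for u
    by (metis \<sigma>_\<tau> \<tau>_\<sigma> zero)
qed

lemma inverse_funpow_hom: "inj_idom_hom (\<tau> ^^ k)"
  by (intro inj_idom_hom_funpow inverse_hom)

lemma funpow_Ints_iff: "(\<sigma> ^^ k) u \<in> \<int> \<longleftrightarrow> u \<in> \<int>"
proof
  interpret S: inj_idom_hom "\<sigma> ^^ k" by (rule funpow_hom)
  interpret T: inj_idom_hom "\<tau> ^^ k" by (rule inverse_funpow_hom)
  show "u \<in> \<int> \<Longrightarrow> (\<sigma> ^^ k) u \<in> \<int>"
    by (auto elim!: Ints_cases simp: S.of_int)
  show "(\<sigma> ^^ k) u \<in> \<int> \<Longrightarrow> u \<in> \<int>"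
    by (metis Ints_cases Ints_of_int T.of_int funpow_\<tau>_\<sigma>)
qed

lemma inverse_funpow_Ints_iff: "(\<tau> ^^ k) u \<in> \<int> \<longleftrightarrow> u \<in> \<int>"
  using funpow_Ints_iff[of k "(\<tau> ^^ k) u"] by simp

text \<open>Powers of \<open>\<sigma>\<close> and \<open>\<tau>\<close> preserve \<int>, so any
  congruence in the orbit can be moved to one between \<open>\<beta>\<close> and a positive
  iterate.\<close>

lemma incongruent_orbit:
  assumes "\<And>t. t > 0 \<Longrightarrow> (\<sigma> ^^ t) \<beta> - \<beta> \<notin> \<int>" "k \<noteq> l"
  shows "(\<sigma> ^^ k) \<beta> - (\<sigma> ^^ l) \<beta> \<notin> \<int>" "(\<tau> ^^ k) \<beta> - (\<tau> ^^ l) \<beta> \<notin> \<int>"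
proof -
  have less: "(\<sigma> ^^ k) \<beta> - (\<sigma> ^^ l) \<beta> \<notin> \<int>" "(\<tau> ^^ l) \<beta> - (\<tau> ^^ k) \<beta> \<notin> \<int>" if "l < k" for k l
  proof -
    interpret S: inj_idom_hom "\<sigma> ^^ l" by (rule funpow_hom)
    interpret T: inj_idom_hom "\<tau> ^^ k" by (rule inverse_funpow_hom)
    have "k = l + (k - l)" "k = (k - l) + l" "k - l > 0"
      using \<open>l < k\<close> by auto
    have "(\<sigma> ^^ k) \<beta> - (\<sigma> ^^ l) \<beta> = (\<sigma> ^^ l) ((\<sigma> ^^ (k - l)) \<beta> - \<beta>)"
      by (subst \<open>k = l + (k - l)\<close>) (simp only: funpow_add o_apply S.diff)
    then show "(\<sigma> ^^ k) \<beta> - (\<sigma> ^^ l) \<beta> \<notin> \<int>"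
      using assms(1)[OF \<open>k - l > 0\<close>] by (simp add: funpow_Ints_iff)
    have "(\<tau> ^^ k) ((\<sigma> ^^ (k - l)) \<beta>) = (\<tau> ^^ l) \<beta>"
      by (subst \<open>k = l + (k - l)\<close>) (simp only: funpow_add o_apply funpow_\<tau>_\<sigma>)
    then have "(\<tau> ^^ l) \<beta> - (\<tau> ^^ k) \<beta> = (\<tau> ^^ k) ((\<sigma> ^^ (k - l)) \<beta> - \<beta>)"
      by (simp add: T.diff)
    then show "(\<tau> ^^ l) \<beta> - (\<tau> ^^ k) \<beta> \<notin> \<int>"
      using assms(1)[OF \<open>k - l > 0\<close>] by (simp add: inverse_funpow_Ints_iff)
  qed
  show "(\<sigma> ^^ k) \<beta> - (\<sigma> ^^ l) \<beta> \<notin> \<int>" "(\<tau> ^^ k) \<beta> - (\<tau> ^^ l) \<beta> \<notin> \<int>"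
    using less[of l k] less[of k l] \<open>k \<noteq> l\<close> diff_in_Ints_commute by (metis linorder_neqE_nat)+
qed

text \<open>Treats a single orbit: by the last two assumptions, the class of \<open>\<beta>\<close>
  is the only one on it, in either direction, where \<open>f\<close> has a residue.\<close>

lemma residue_periodic:
  assumes "j > 0" and f: "f = map_coeffs \<sigma> g - g + (shift_var h - h)"
    and "residue j f \<beta> \<noteq> 0"
    and orbit: "\<And>k. (\<sigma> ^^ k) \<beta> - \<beta> \<notin> \<int> \<Longrightarrow> residue j f ((\<sigma> ^^ k) \<beta>) = 0"
    and inverse_orbit: "\<And>k. (\<tau> ^^ k) \<beta> - \<beta> \<notin> \<int> \<Longrightarrow> residue j f ((\<tau> ^^ k) \<beta>) = 0"
  obtains t \<gamma> where "t > 0" "(\<sigma> ^^ t) \<beta> - \<beta> \<in> \<int>" "residue j f \<beta> = (\<sigma> ^^ t) \<gamma> - \<gamma>"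
proof -
  define r where "r = residue j g"
  have step: "residue j f (\<sigma> b) = \<sigma> (r b) - r (\<sigma> b)" for b
    by (simp add: f residue_add residue_diff residue_shift_var residue_map_coeffs[OF inj_idom_hom_axioms]
        r_def \<open>j > 0\<close>)
  have "\<exists>t>0. (\<sigma> ^^ t) \<beta> - \<beta> \<in> \<int>"
  proof (rule ccontr)
    assume "\<not> ?thesis"
    then have incong: "\<And>t. t > 0 \<Longrightarrow> (\<sigma> ^^ t) \<beta> - \<beta> \<notin> \<int>"
      by blast
    have fwd_incong: "(\<sigma> ^^ k) \<beta> - (\<sigma> ^^ l) \<beta> \<notin> \<int>"
      and bwd_incong: "(\<tau> ^^ k) \<beta> - (\<tau> ^^ l) \<beta> \<notin> \<int>" if "k \<noteq> l" for k l
      using incongruent_orbit[of \<beta> k l] incong that by auto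
    have "r (\<sigma> ((\<sigma> ^^ k) \<beta>)) = \<sigma> (r ((\<sigma> ^^ k) \<beta>))" for k
      using step[of "(\<sigma> ^^ k) \<beta>"] orbit[of "Suc k"] incong[of "Suc k"] by simp
    then have fwd: "r ((\<sigma> ^^ k) \<beta>) = (\<sigma> ^^ k) (r \<beta>)" for k
      by (induction k) simp_all
    obtain k where "r ((\<sigma> ^^ k) \<beta>) = 0"
      unfolding r_def
      using residue_eventually_0[OF \<open>j > 0\<close>, of "\<lambda>k. (\<sigma> ^^ k) \<beta>"] fwd_incong by blast
    \<comment> \<open>\<open>r\<close> at an iterate is the iterate of \<open>r \<beta>\<close>, so
      one zero on the orbit suffices.\<close>
    then have 0: "r \<beta> = 0"
      using fwd inj_idom_hom.eq_0_iff[OF funpow_hom] by metis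
    \<comment> \<open>Backwards the chain starts at \<open>\<tau> \<beta>\<close>: the step from
      there to \<open>\<beta>\<close> meets the residue of \<open>f\<close>.\<close>
    have "\<sigma> (r ((\<tau> ^^ Suc (Suc k)) \<beta>)) = r ((\<tau> ^^ Suc k) \<beta>)" for k
      using step[of "(\<tau> ^^ Suc (Suc k)) \<beta>"] inverse_orbit[of "Suc k"]
        bwd_incong[of "Suc k" 0] by simp
    then have bwd: "(\<sigma> ^^ k) (r ((\<tau> ^^ Suc k) \<beta>)) = r (\<tau> \<beta>)" for k
      by (induction k) (simp, metis funpow_Suc_right o_apply)
    obtain k where "r ((\<tau> ^^ Suc k) \<beta>) = 0"
      unfolding r_def
      using residue_eventually_0[OF \<open>j > 0\<close>, of "\<lambda>k. (\<tau> ^^ Suc k) \<beta>"] bwd_incong by blast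
    then have "r (\<tau> \<beta>) = 0"
      using bwd inj_idom_hom.zero[OF funpow_hom] by metis
    then have "residue j f \<beta> = 0"
      using step[of "\<tau> \<beta>"] 0 by simp
    then show False
      using assms by simp
  qed
  \<comment> \<open>Minimality of \<open>t\<close> ensures that no intermediate iterate meets the
    residue of \<open>f\<close>.\<close>
  define t where "t = (LEAST t. t > 0 \<and> (\<sigma> ^^ t) \<beta> - \<beta> \<in> \<int>)"
  have t: "t > 0" "(\<sigma> ^^ t) \<beta> - \<beta> \<in> \<int>"
    using LeastI_ex[OF \<open>\<exists>t>0. _\<close>] by (simp_all add: t_def)
  have least: "(\<sigma> ^^ k) \<beta> - \<beta> \<notin> \<int>" if "0 < k" "k < t" for k
    using not_less_Least[of k "\<lambda>t. t > 0 \<and> (\<sigma> ^^ t) \<beta> - \<beta> \<in> \<int>"] that by (simp add: t_def)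
  have iter: "k < t \<Longrightarrow> r ((\<sigma> ^^ k) \<beta>) = (\<sigma> ^^ k) (r \<beta>)" for k
  proof (induction k)
    case (Suc k)
    then show ?case
      using step[of "(\<sigma> ^^ k) \<beta>"] orbit[of "Suc k"] least[of "Suc k"] by simp
  qed simp
  obtain n where "(\<sigma> ^^ t) \<beta> - \<beta> = of_int n"
    using t by (auto elim: Ints_cases)
  then have n: "(\<sigma> ^^ t) \<beta> = \<beta> + of_int n"
    by (simp add: algebra_simps)
  \<comment> \<open>Only the last step, from exponent \<open>t - 1\<close> to \<open>t\<close>,
    picks up the residue of \<open>f\<close>; as \<open>(\<sigma> ^^ t) \<beta>\<close> is congruent
    to \<open>\<beta>\<close>, both residues may be taken at \<open>\<beta>\<close>.\<close>
  have "Suc (t - 1) = t"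
    using t by simp
  then have "residue j f ((\<sigma> ^^ t) \<beta>) = (\<sigma> ^^ t) (r \<beta>) - r ((\<sigma> ^^ t) \<beta>)"
    using step[of "(\<sigma> ^^ (t - 1)) \<beta>"] iter[of "t - 1"] funpow.simps(2)[of "t - 1" \<sigma>] by simp
  then have "residue j f \<beta> = (\<sigma> ^^ t) (r \<beta>) - r \<beta>"
    unfolding n by (simp add: residue_of_int r_def)
  with t show thesis
    by (rule that)
qed

end

text \<open>Gives characteristic zero for \<open>F(x)\<close>, and through it for its closure, as
  residues and division by degrees require.\<close>

instance fract :: ("{idom,ring_char_0}") field_char_0
proof
  have "inj (\<lambda>n. to_fract (of_nat n) :: 'a fract)"
    by (auto intro: injI)
  then show "inj (of_nat :: nat \<Rightarrow> 'a fract)"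
    by (simp add: inj_idom_hom.of_nat[OF inj_idom_hom_to_fract])
qed

section \<open>Algebraic elements over the rational function field\<close>

text \<open>Reads off the top two terms of \<open>(X + a)^(n+1)\<close>. The second conclusion feeds
  the induction for the first.\<close>

lemma coeff_pcompose_translate:
  fixes p :: "'a::comm_ring_1 poly"
  assumes "degree p \<le> Suc n"
  shows "coeff (pcompose p [:a, 1:]) n = coeff p n + of_nat (Suc n) * a * coeff p (Suc n)"
    and "coeff (pcompose p [:a, 1:]) (Suc n) = coeff p (Suc n)"
  using assms
proof (induction p arbitrary: n)
  case (pCons c p)
  case 1
  then have deg: "degree p \<le> n"
    by (simp split: if_splits)
  show ?case
  proof (cases n)
    case 0
    then obtain d where "p = [:d:]"
      using deg by (metis degree_eq_zeroE le_zero_eq)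
    then show ?thesis
      using 0 by (simp add: pcompose_pCons)
  next
    case (Suc k)
    then show ?thesis
      using pCons.IH[of k] deg by (simp add: pcompose_pCons algebra_simps)
  qed
next
  case (pCons c p)
  case 2
  then have deg: "degree p \<le> n"
    by (simp split: if_splits)
  show ?case
  proof (cases n)
    case 0
    then obtain d where "p = [:d:]"
      using deg by (metis degree_eq_zeroE le_zero_eq)
    then show ?thesis
      using 0 by (simp add: pcompose_pCons)
  next
    case (Suc k)
    moreover have "coeff (pcompose p [:a, 1:]) (Suc (Suc k)) = 0"
      using deg Suc by (intro coeff_eq_0) (use degree_pcompose_le[of p "[:a, 1:]"] in simp)
    moreover have "coeff p (Suc (Suc k)) = 0"
      using deg Suc by (intro coeff_eq_0) simp
    ultimately show ?thesis
      using pCons.IH[of k] deg by (simp add: pcompose_pCons)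
  qed
qed simp_all

text \<open>Over an algebraically closed field \<open>p\<close> splits off a linear factor;
  \<open>z\<close> is the image of its root or a root of the smaller cofactor.\<close>

lemma alg_closed_root_in_range:
  fixes \<phi> :: "'a::alg_closed_field \<Rightarrow> 'b::idom"
  assumes "inj_idom_hom \<phi>" "p \<noteq> 0" "poly (map_poly \<phi> p) z = 0"
  shows "z \<in> range \<phi>"
proof -
  interpret inj_idom_hom \<phi> by fact
  interpret P: inj_idom_hom "map_poly \<phi>" by (rule map_poly_hom)
  show ?thesis
    using assms(2,3)
  proof (induction "degree p" arbitrary: p rule: less_induct)
    case less
    have "degree p > 0"
    proof (rule ccontr)
      assume "\<not> degree p > 0"
      then obtain c where "p = [:c:]"
        by (metis degree_eq_zeroE neq0_conv)
      then show False
        using less.prems by (simp add: map_poly_pCons)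
    qed
    then obtain u where "poly p u = 0"
      using alg_closed_imp_poly_has_root by blast
    then obtain q where p: "p = [:-u, 1:] * q"
      by (metis dvdE poly_eq_0_iff_dvd)
    then have "q \<noteq> 0"
      using less.prems by auto
    then have "degree q < degree p"
      unfolding p by (subst degree_mult_eq) auto
    have "(z - \<phi> u) * poly (map_poly \<phi> q) z = 0"
      using less.prems unfolding p P.mult poly_mult
      by (simp add: map_poly_pCons uminus)
    then show ?case
      using less.hyps[OF \<open>degree q < degree p\<close> \<open>q \<noteq> 0\<close>] by auto
  qed
qed

section \<open>Invariants of the shift on \<open>F(x)\<close>\<close>

lemma funpow_shift_var:
  assumes "b \<noteq> 0"
  shows "(shift_var ^^ t) (Fract a b) = Fract (pcompose a [:of_nat t, 1:]) (pcompose b [:of_nat t, 1:])"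
proof (induction t)
  case (Suc t)
  interpret inj_idom_hom "\<lambda>p::'a poly. pcompose p [:1, 1:]"
    by (rule inj_idom_hom_translate)
  have "pcompose b [:of_nat t, 1:] \<noteq> 0"
    using inj_idom_hom.eq_0_iff[OF inj_idom_hom_translate] assms by metis
  then show ?case
    using Suc by (simp add: shift_var_def map_fract pcompose_pCons add.commute flip: pcompose_assoc)
next
  case 0
  then show ?case
    by simp
qed

text \<open>The quotient \<open>a / b\<close> takes one value \<open>c\<close> at all large
  multiples of \<open>t\<close>, so \<open>a - smult c b\<close> has infinitely many roots.\<close>

lemma shift_invariant_imp_const:
  fixes r :: "'a::field_char_0 poly fract"
  assumes "t > 0" "(shift_var ^^ t) r = r"
  shows "\<exists>c. r = to_fract [:c:]"
proof (cases r)
  case (Fract a b)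
  have "pcompose b [:of_nat t, 1:] \<noteq> 0"
    using inj_idom_hom.eq_0_iff[OF inj_idom_hom_translate] Fract by metis
  then have eq: "pcompose a [:of_nat t, 1:] * b = a * pcompose b [:of_nat t, 1:]"
    using assms Fract by (simp add: funpow_shift_var eq_fract)
  define e :: "nat \<Rightarrow> 'a" where "e n = of_nat (n * t)" for n
  have "inj e"
    using \<open>t > 0\<close> by (auto intro!: injI simp: e_def simp del: of_nat_mult)
  have "finite {n. poly b (e n) = 0}"
    using finite_vimageI[OF poly_roots_finite[OF \<open>b \<noteq> 0\<close>] \<open>inj e\<close>] by (simp add: vimage_def)
  then obtain N where N: "\<And>n. n \<ge> N \<Longrightarrow> poly b (e n) \<noteq> 0"
    by (metis (mono_tags) finite_nat_set_iff_bounded mem_Collect_eq not_le)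
  define c where "c = poly a (e N) / poly b (e N)"
  have "poly a (e n) = c * poly b (e n)" if "n \<ge> N" for n
    using that
  proof (induction n rule: dec_induct)
    case base
    then show ?case
      using N[of N] by (simp add: c_def)
  next
    case (step n)
    \<comment> \<open>Evaluating \<open>eq\<close> at \<open>e n\<close> compares the values at two
      consecutive multiples of \<open>t\<close>.\<close>
    have "poly a (e (Suc n)) * poly b (e n) = poly a (e n) * poly b (e (Suc n))"
      using arg_cong[OF eq, of "\<lambda>p. poly p (e n)"] by (simp add: poly_pcompose e_def algebra_simps)
    then show ?case
      using step N[of n] by simp
  qed
  then have "e ` {N..} \<subseteq> {x. poly (a - smult c b) x = 0}"
    by auto
  moreover have "infinite (e ` {N..})"
    using finite_imageD[OF _ inj_on_subset[OF \<open>inj e\<close> subset_UNIV]] infinite_Ici by blast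
  ultimately have "a - smult c b = 0"
    using poly_roots_finite finite_subset by blast
  then have "r = to_fract [:c:]"
    using Fract by (simp add: to_fract_def eq_fract)
  then show ?thesis
    by blast
qed

section \<open>Automorphisms of the closure that extend the shift\<close>

locale shift_extension =
  fixes \<sigma> :: "'a::field_char_0 rat_closure \<Rightarrow> 'a rat_closure"
  assumes extends_shift: "extends_shift \<sigma>"

sublocale shift_extension \<subseteq> field_aut \<sigma>
proof
  have "bij \<sigma>" and add: "\<And>u v. \<sigma> (u + v) = \<sigma> u + \<sigma> v"
    and mult: "\<And>u v. \<sigma> (u * v) = \<sigma> u * \<sigma> v"
    using extends_shift by (auto simp: extends_shift_def)
  then show "\<sigma> (u + v) = \<sigma> u + \<sigma> v" "\<sigma> (u * v) = \<sigma> u * \<sigma> v" "surj \<sigma>" for u v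
    by (simp_all add: bij_is_surj)
  have "\<sigma> 0 = 0"
    using add[of 0 0] by simp
  then show "\<sigma> u = 0 \<longleftrightarrow> u = 0" for u
    using bij_is_inj[OF \<open>bij \<sigma>\<close>] by (metis injD)
qed

context shift_extension
begin

lemma funpow_to_ac: "(\<sigma> ^^ t) (to_ac r) = to_ac ((shift_var ^^ t) r)"
  using extends_shift by (induction t) (auto simp: extends_shift_def)

lemma funpow_const_x: "(\<sigma> ^^ t) (const_x c) = const_x c"
  by (simp add: const_x_def funpow_to_ac to_fract_def funpow_shift_var pcompose_pCons pcompose_1)

lemma funpow_var_x: "(\<sigma> ^^ t) var_x = var_x + of_nat t"
proof -
  have "(\<sigma> ^^ t) var_x = to_ac (to_fract [:of_nat t, 1:])"
    by (simp add: var_x_def funpow_to_ac to_fract_def funpow_shift_var pcompose_pCons pcompose_1)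
  also have "[:of_nat t, 1:] = [:0, 1:] + (of_nat t :: 'a poly)"
    by (simp add: of_nat_poly)
  finally show ?thesis
    by (simp add: var_x_def inj_idom_hom.of_nat[OF inj_idom_hom_to_fract])
qed

text \<open>
  Here \<open>p\<close> is the minimal polynomial of \<open>\<gamma>\<close>: both sides of the last equation annihilate \<open>\<gamma>\<close>, and
  a difference of two monic annihilating polynomials of least degree must vanish.
\<close>

lemma obtain_equivariant_poly:
  assumes \<gamma>: "(\<sigma> ^^ t) \<gamma> = \<gamma> + to_ac a"
  obtains p where "lead_coeff p = 1" "degree p > 0" "poly (map_poly to_ac p) \<gamma> = 0"
    "pcompose (map_poly (shift_var ^^ t) p) [:a, 1:] = p"
proof -
  interpret E: inj_idom_hom "to_ac :: 'a poly fract \<Rightarrow> _" by (rule inj_idom_hom_to_ac)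
  interpret EP: inj_idom_hom "map_poly (to_ac :: 'a poly fract \<Rightarrow> _)" by (rule E.map_poly_hom)
  interpret S: inj_idom_hom "\<sigma> ^^ t" by (rule funpow_hom)
  interpret T: inj_idom_hom "shift_var ^^ t :: 'a poly fract \<Rightarrow> _"
    by (intro inj_idom_hom_funpow inj_idom_hom_shift_var)
  define ann where "ann p \<longleftrightarrow> p \<noteq> 0 \<and> poly (map_poly to_ac p) \<gamma> = 0" for p
  obtain p0 where "ann p0"
    using alg_closure_algebraic[of \<gamma>] unfolding ann_def by metis
  then obtain p1 where p1: "ann p1" "\<And>q. ann q \<Longrightarrow> degree p1 \<le> degree q"
    using ex_has_least_nat[of ann p0 degree] by blast
  define p where "p = smult (inverse (lead_coeff p1)) p1"
  have "lead_coeff p1 \<noteq> 0"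
    using p1 by (simp add: ann_def)
  then have p: "ann p" "lead_coeff p = 1" "degree p = degree p1"
    using p1 by (simp_all add: p_def ann_def map_poly_smult)
  have "degree p > 0"
  proof (rule ccontr)
    assume "\<not> degree p > 0"
    then obtain c where "p = [:c:]"
      by (metis degree_eq_zeroE neq0_conv)
    then show False
      using p by (simp add: ann_def map_poly_pCons)
  qed
  define q where "q = pcompose (map_poly (shift_var ^^ t) p) [:a, 1:]"
  have "degree (map_poly (shift_var ^^ t) p) = degree p"
    by (rule degree_map_poly) simp
  moreover have "lead_coeff q = lead_coeff (map_poly (shift_var ^^ t) p)"
    unfolding q_def by (subst lead_coeff_comp) simp_all
  ultimately have q: "degree q = degree p" "lead_coeff q = 1"
    using p by (simp_all add: q_def degree_pcompose coeff_map_poly)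
  \<comment> \<open>The value of \<open>q\<close> at \<open>\<gamma>\<close> is that of the image of
    \<open>p\<close> under \<open>\<sigma> ^^ t\<close> at \<open>\<gamma> + to_ac a\<close>, which
    is \<open>(\<sigma> ^^ t) \<gamma>\<close>.\<close>
  have "map_poly to_ac (map_poly (shift_var ^^ t) p) = map_poly (\<sigma> ^^ t) (map_poly to_ac p)"
    by (rule poly_eqI) (simp add: coeff_map_poly funpow_to_ac)
  then have "poly (map_poly to_ac q) \<gamma> = poly (map_poly (\<sigma> ^^ t) (map_poly to_ac p)) ((\<sigma> ^^ t) \<gamma>)"
    by (simp add: q_def map_poly_translate[OF inj_idom_hom_to_ac] poly_pcompose \<gamma> add.commute)
  also have "\<dots> = 0"
    using p by (simp add: S.poly_map_poly ann_def)
  finally have "poly (map_poly to_ac (q - p)) \<gamma> = 0"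
    using p by (simp add: EP.diff ann_def)
  have "q = p"
  proof (rule ccontr)
    assume "q \<noteq> p"
    then have "ann (q - p)"
      using \<open>poly _ \<gamma> = 0\<close> by (simp add: ann_def)
    then have "degree p \<le> degree (q - p)"
      using p1 p by simp
    moreover have "degree (q - p) < degree p"
      using q p \<open>degree p > 0\<close> \<open>q \<noteq> p\<close>
      by (intro degree_lessI) (auto simp: coeff_eq_0 le_less)
    ultimately show False
      by simp
  qed
  with p \<open>degree p > 0\<close> show thesis
    by (intro that[of p]) (auto simp: ann_def q_def)
qed

text \<open>For \<open>a = 0\<close>, \<open>obtain_equivariant_poly\<close> makes all coefficients
  invariant, hence constants by \<open>shift_invariant_imp_const\<close>.\<close>

lemma funpow_fixed_imp_const:
  fixes \<gamma> :: "'a rat_closure"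
  assumes "t > 0" "(\<sigma> ^^ t) \<gamma> = \<gamma>"
  obtains p where "p \<noteq> 0" "poly (map_poly const_x p) \<gamma> = 0"
proof -
  interpret T: inj_idom_hom "shift_var ^^ t :: 'a poly fract \<Rightarrow> _"
    by (intro inj_idom_hom_funpow inj_idom_hom_shift_var)
  obtain p where p: "lead_coeff p = 1" "poly (map_poly to_ac p) \<gamma> = 0"
    and inv: "pcompose (map_poly (shift_var ^^ t) p) [:0, 1:] = p"
    using obtain_equivariant_poly[of t \<gamma> 0] assms by auto
  have "(shift_var ^^ t) (coeff p n) = coeff p n" for n
    using arg_cong[OF inv, of "\<lambda>p. coeff p n"] by (simp add: pcompose_idR coeff_map_poly)
  then have "\<exists>c. coeff p n = to_fract [:c:]" for n
    using shift_invariant_imp_const assms by blast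
  then obtain c where c: "\<And>n. coeff p n = to_fract [:c n:]"
    by metis
  \<comment> \<open>The chosen constants must vanish beyond the degree before
    \<open>Abs_poly\<close> can be applied.\<close>
  have "c n = 0" if "n > degree p" for n
    using c[of n] that by (simp add: coeff_eq_0)
  then have "coeff (Abs_poly c) n = c n" for n
    by (subst Abs_poly_inverse) (auto simp: MOST_nat)
  then have "map_poly const_x (Abs_poly c) = map_poly to_ac p"
    by (intro poly_eqI)
      (simp add: coeff_map_poly c const_x_def inj_idom_hom.zero[OF inj_idom_hom_const_x])
  moreover have "p \<noteq> 0"
    using p by auto
  ultimately show thesis
    using p that[of "Abs_poly c"] 
    by (metis inj_idom_hom.eq_0_iff inj_idom_hom.map_poly_hom inj_idom_hom_const_x inj_idom_hom_to_ac)
qed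

text \<open>Averaging over the roots of an equivariant polynomial moves the witness into
  \<open>F(x)\<close>.\<close>

lemma difference_descends:
  assumes "(\<sigma> ^^ t) \<gamma> - \<gamma> \<in> range to_ac"
  obtains \<delta> where "\<delta> \<in> range to_ac" "(\<sigma> ^^ t) \<delta> - \<delta> = (\<sigma> ^^ t) \<gamma> - \<gamma>"
proof -
  interpret T: inj_idom_hom "shift_var ^^ t :: 'a poly fract \<Rightarrow> _"
    by (intro inj_idom_hom_funpow inj_idom_hom_shift_var)
  obtain a where "(\<sigma> ^^ t) \<gamma> - \<gamma> = to_ac a"
    using assms by auto
  then have a: "(\<sigma> ^^ t) \<gamma> = \<gamma> + to_ac a"
    by (simp add: algebra_simps)
  obtain p where p: "lead_coeff p = 1" "degree p > 0"
    and inv: "pcompose (map_poly (shift_var ^^ t) p) [:a, 1:] = p"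
    using obtain_equivariant_poly[OF a] by metis
  obtain n where n: "degree p = Suc n"
    using p by (cases "degree p") auto
  have "degree (map_poly (shift_var ^^ t) p) \<le> Suc n"
    using n by (simp add: degree_map_poly)
  \<comment> \<open>Comparison of the coefficients just below the leading one.\<close>
  then have "coeff p n - (shift_var ^^ t) (coeff p n) = of_nat (Suc n) * a"
    using coeff_pcompose_translate(1)[of "map_poly (shift_var ^^ t) p" n a] p
    by (simp add: inv coeff_map_poly n diff_eq_eq add.commute del: of_nat_Suc)
  \<comment> \<open>As \<open>p\<close> is monic, \<open>- coeff p n\<close> is the sum of its
    roots, so \<open>d\<close> is their mean.\<close>
  moreover define d where "d = - coeff p n / of_nat (Suc n)"
  moreover have "(shift_var ^^ t) d = - (shift_var ^^ t) (coeff p n) / of_nat (Suc n)"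
    unfolding d_def inj_idom_hom_divide[OF T.inj_idom_hom_axioms] T.uminus T.of_nat ..
  ultimately have "of_nat (Suc n) * ((shift_var ^^ t) d - d) = of_nat (Suc n) * a"
    by (simp add: right_diff_distrib del: of_nat_Suc)
  then have "(shift_var ^^ t) d - d = a"
    by (simp del: of_nat_Suc)
  then have "(\<sigma> ^^ t) (to_ac d) - to_ac d = to_ac a"
    by (simp add: funpow_to_ac flip: to_ac_diff)
  then show thesis
    using that[of "to_ac d"] a by simp
qed

end

section \<open>The summability criterion\<close>

lemma xy_summable_add:
  assumes "inj_idom_hom \<sigma>" "xy_summable \<sigma> p" "xy_summable \<sigma> q"
  shows "xy_summable \<sigma> (p + q)"
proof -
  interpret X: inj_idom_hom "map_coeffs \<sigma>" by (intro inj_idom_hom_map_coeffs assms)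
  interpret Y: inj_idom_hom "shift_var :: 'a poly fract \<Rightarrow> _" by (rule inj_idom_hom_shift_var)
  obtain g h g' h' where "p = map_coeffs \<sigma> g - g + (shift_var h - h)"
    "q = map_coeffs \<sigma> g' - g' + (shift_var h' - h')"
    using assms by (auto simp: xy_summable_def)
  then have "p + q = map_coeffs \<sigma> (g + g') - (g + g') + (shift_var (h + h') - (h + h'))"
    by (simp add: X.add Y.add)
  then show ?thesis
    by (auto simp: xy_summable_def)
qed

lemma xy_summable_uminus:
  assumes "inj_idom_hom \<sigma>" "xy_summable \<sigma> p"
  shows "xy_summable \<sigma> (- p)"
proof -
  interpret X: inj_idom_hom "map_coeffs \<sigma>" by (intro inj_idom_hom_map_coeffs assms)
  interpret Y: inj_idom_hom "shift_var :: 'a poly fract \<Rightarrow> _" by (rule inj_idom_hom_shift_var)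
  obtain g h where "p = map_coeffs \<sigma> g - g + (shift_var h - h)"
    using assms by (auto simp: xy_summable_def)
  then have "- p = map_coeffs \<sigma> (- g) - (- g) + (shift_var (- h) - (- h))"
    by (simp add: X.uminus Y.uminus)
  then show ?thesis
    unfolding xy_summable_def by blast
qed

lemma xy_summable_x:
  assumes "inj_idom_hom \<sigma>"
  shows "xy_summable \<sigma> (map_coeffs \<sigma> g - g)"
  unfolding xy_summable_def
  by (rule exI[of _ g], rule exI[of _ 0]) (simp add: inj_idom_hom.zero[OF inj_idom_hom_shift_var])

lemma xy_summable_y:
  assumes "inj_idom_hom \<sigma>"
  shows "xy_summable \<sigma> (shift_var h - h)"
  unfolding xy_summable_def
  by (rule exI[of _ 0], rule exI[of _ h])
    (simp add: inj_idom_hom.zero[OF inj_idom_hom_map_coeffs[OF assms]])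

lemma xy_summable_0: "inj_idom_hom \<sigma> \<Longrightarrow> xy_summable \<sigma> 0"
  using xy_summable_add xy_summable_uminus xy_summable_x by (metis add.right_inverse)

lemma xy_summable_sum:
  assumes "inj_idom_hom \<sigma>" "\<And>i. i \<in> A \<Longrightarrow> xy_summable \<sigma> (f i)"
  shows "xy_summable \<sigma> (\<Sum>i\<in>A. f i)"
  using assms(2)
  by (induction A rule: infinite_finite_induct) (simp_all add: xy_summable_0 xy_summable_add assms(1))

section \<open>Pole terms modulo summable elements\<close>

lemma map_coeffs_pole:
  assumes "inj_idom_hom \<sigma>"
  shows "map_coeffs \<sigma> (pole j \<alpha> \<beta>) = pole j (\<sigma> \<alpha>) (\<sigma> \<beta>)"
proof -
  interpret inj_idom_hom \<sigma> by fact
  interpret P: inj_idom_hom "map_poly \<sigma>" by (rule map_poly_hom)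
  show ?thesis
    by (simp add: map_coeffs_def pole_conv_Fract P.map_fract P.power map_poly_pCons uminus)
qed

lemma shift_var_pole: "shift_var (pole j \<alpha> \<beta>) = pole j \<alpha> (\<beta> - 1)"
proof -
  interpret inj_idom_hom "\<lambda>p::'a poly. pcompose p [:1, 1:]"
    by (rule inj_idom_hom_translate)
  show ?thesis
    by (simp add: shift_var_def pole_conv_Fract map_fract power pcompose_pCons)
qed

lemma pole_diff: "pole j (\<alpha> - \<alpha>') \<beta> = pole j \<alpha> \<beta> - pole j \<alpha>' \<beta>"
proof -
  have "const_y (\<alpha> - \<alpha>') = const_y \<alpha> - const_y \<alpha>'"
    by (simp add: const_y_def flip: to_fract_diff)
  then show ?thesis
    by (simp add: pole_def diff_divide_distrib)
qed

lemma xy_summable_pole_translate: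
  assumes "inj_idom_hom \<sigma>"
  shows "xy_summable \<sigma> (pole j \<alpha> (\<beta> + of_int n) - pole j \<alpha> \<beta>)"
proof -
  have nat: "xy_summable \<sigma> (pole j \<alpha> (\<beta> + of_nat k) - pole j \<alpha> \<beta>)" for k \<beta>
  proof (induction k)
    case (Suc k)
    \<comment> \<open>\<open>shift_var\<close> lowers the pole by 1, so \<open>?h\<close> sits at
      the upper end and its difference enters with a minus sign.\<close>
    let ?h = "pole j \<alpha> (\<beta> + of_nat (Suc k))"
    have "pole j \<alpha> (\<beta> + of_nat (Suc k)) - pole j \<alpha> \<beta> =
        (pole j \<alpha> (\<beta> + of_nat k) - pole j \<alpha> \<beta>) + - (shift_var ?h - ?h)"
      by (simp add: shift_var_pole)
    then show ?case
      using xy_summable_add[OF assms Suc xy_summable_uminus[OF assms xy_summable_y[OF assms]]]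
      by metis
  qed (simp add: xy_summable_0 assms)
  show ?thesis
  proof (cases n rule: int_cases2)
    case (nonneg k)
    then show ?thesis
      using nat[of \<beta> k] by simp
  next
    \<comment> \<open>A descent is the negative of an ascent that starts at
      \<open>\<beta> + of_int n\<close>.\<close>
    case (nonpos k)
    then show ?thesis
      using xy_summable_uminus[OF assms nat[of "\<beta> + of_int n" k]] by simp
  qed
qed

text \<open>Telescoping in x: each application of \<open>\<sigma>\<close> moves numerator and pole
  together.\<close>

lemma xy_summable_pole_funpow:
  assumes "inj_idom_hom \<sigma>"
  shows "xy_summable \<sigma> (pole j ((\<sigma> ^^ t) \<gamma>) ((\<sigma> ^^ t) \<beta>) - pole j \<gamma> \<beta>)"
proof (induction t)
  case (Suc t)
  show ?case
    using xy_summable_add[OF assms Suc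
        xy_summable_x[OF assms, of "pole j ((\<sigma> ^^ t) \<gamma>) ((\<sigma> ^^ t) \<beta>)"]]
    by (simp add: map_coeffs_pole[OF assms])
qed (simp add: xy_summable_0 assms)

text \<open>Modulo summable elements, the term of \<open>\<gamma>\<close> at \<open>\<beta>\<close>
  equals that of \<open>(\<sigma> ^^ t) \<gamma>\<close> at \<open>\<beta> + of_int s\<close>, and
  the latter can be moved back to \<open>\<beta>\<close>.\<close>

lemma xy_summable_pole:
  assumes "inj_idom_hom \<sigma>" "(\<sigma> ^^ t) \<beta> = \<beta> + of_int s"
  shows "xy_summable \<sigma> (pole j ((\<sigma> ^^ t) \<gamma> - \<gamma>) \<beta>)"
  using xy_summable_add[OF assms(1) xy_summable_pole_funpow[OF assms(1), of j t \<gamma> \<beta>]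
      xy_summable_uminus[OF assms(1) xy_summable_pole_translate[OF assms(1), of j "(\<sigma> ^^ t) \<gamma>" \<beta> s]]]
  by (simp add: pole_diff assms(2))

section \<open>Linear poles and integer iterates of the shift\<close>

context shift_extension
begin

lemma funpow_linear:
  assumes "t > 0" "\<beta> = of_int s / of_nat t * var_x + const_x c"
  shows "(\<sigma> ^^ t) \<beta> = \<beta> + of_int s"
proof -
  interpret S: inj_idom_hom "\<sigma> ^^ t" by (rule funpow_hom)
  show ?thesis
    using assms
    by (simp add: S.add S.mult S.of_int S.of_nat inj_idom_hom_divide[OF S.inj_idom_hom_axioms]
        funpow_var_x funpow_const_x algebra_simps)
qed

lemma int_iterate_cases:
  assumes "\<And>n. \<beta> - int_iterate \<sigma> n \<beta>' \<notin> \<int>"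
  shows "\<beta> - (\<sigma> ^^ k) \<beta>' \<notin> \<int>" "\<beta> - (\<tau> ^^ k) \<beta>' \<notin> \<int>"
  using assms[of "int k"] assms[of "- int k"] by (auto simp: int_iterate_def split: if_splits)

text \<open>Applying the inverse power of \<open>\<sigma>\<close> exchanges the two points up to
  sign and preserves \<int>. This makes incongruence, assumed only for \<open>i < i'\<close>,
  symmetric.\<close>

lemma int_iterate_swap:
  assumes "\<And>n. \<beta> - int_iterate \<sigma> n \<beta>' \<notin> \<int>"
  shows "\<beta>' - int_iterate \<sigma> n \<beta> \<notin> \<int>"
proof -
  interpret S: inj_idom_hom "\<sigma> ^^ k" for k by (rule funpow_hom)
  interpret T: inj_idom_hom "\<tau> ^^ k" for k by (rule inverse_funpow_hom)
  have "\<beta>' - (\<sigma> ^^ k) \<beta> \<notin> \<int>" for k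
    using int_iterate_cases(2)[OF assms, of k] inverse_funpow_Ints_iff[of k "\<beta>' - (\<sigma> ^^ k) \<beta>"] diff_in_Ints_commute
    by (auto simp: T.diff)
  moreover have "\<beta>' - (\<tau> ^^ k) \<beta> \<notin> \<int>" for k
    using int_iterate_cases(1)[OF assms, of k] funpow_Ints_iff[of k "\<beta>' - (\<tau> ^^ k) \<beta>"] diff_in_Ints_commute
    by (auto simp: S.diff)
  ultimately show ?thesis
    by (simp add: int_iterate_def)
qed

end

text \<open>\<open>\<sigma> ^^ t\<close> adds \<open>s\<close> to both \<open>\<beta>\<close> and
  \<open>(s/t) x\<close>, so their difference is fixed and therefore algebraic over
  \<open>F\<close>. Stated outside the locale because \<open>F\<close> must now be algebraically
  closed.\<close>

lemma linear_if_periodic: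
  fixes \<sigma> :: "'a::{alg_closed_field, field_char_0} rat_closure \<Rightarrow> 'a rat_closure"
  assumes "shift_extension \<sigma>"
    and "t > 0" "(\<sigma> ^^ t) \<beta> - \<beta> \<in> \<int>"
  obtains s c where "\<beta> = of_int s / of_nat t * var_x + const_x c"
proof -
  interpret shift_extension \<sigma> by fact
  interpret S: inj_idom_hom "\<sigma> ^^ t" by (rule funpow_hom)
  obtain s where "(\<sigma> ^^ t) \<beta> - \<beta> = of_int s"
    using assms by (auto elim: Ints_cases)
  then have s: "(\<sigma> ^^ t) \<beta> = \<beta> + of_int s"
    by (simp add: algebra_simps)
  define z where "z = \<beta> - of_int s / of_nat t * var_x"
  have "(\<sigma> ^^ t) z = z"
    using \<open>t > 0\<close>
    by (simp add: z_def s S.diff S.mult S.of_int S.of_nat funpow_var_x algebra_simps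
        inj_idom_hom_divide[OF S.inj_idom_hom_axioms])
  then obtain p where "p \<noteq> 0" "poly (map_poly const_x p) z = 0"
    using funpow_fixed_imp_const \<open>t > 0\<close> by blast
  then obtain c where "z = const_x c"
    using alg_closed_root_in_range[OF inj_idom_hom_const_x] by blast
  then show thesis
    using that[of s c] by (simp add: z_def algebra_simps)
qed

theorem theorem3p7:
  fixes \<sigma> :: "'a::{alg_closed_field, field_char_0} rat_closure \<Rightarrow> 'a rat_closure"
    and \<alpha> \<beta> :: "nat \<Rightarrow> 'a rat_closure" and m j :: nat
    and f :: "'a rat_closure poly fract"
  assumes "extends_shift \<sigma>"
    and "j > 0"
    and "f = (\<Sum>i = 1..m. const_y (\<alpha> i) / (var_y - const_y (\<beta> i)) ^ j)"
    and "\<And>i. i \<in> {1..m} \<Longrightarrow> \<alpha> i \<noteq> 0"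
    and "\<And>i i' (n::int). 1 \<le> i \<Longrightarrow> i < i' \<Longrightarrow> i' \<le> m \<Longrightarrow> \<beta> i - int_iterate \<sigma> n (\<beta> i') \<notin> \<int>"
  shows "xy_summable \<sigma> f \<longleftrightarrow>
    (\<forall>i\<in>{1..m}. \<exists>(s::int) (t::nat) (c::'a) \<gamma>. t > 0 \<and>
       \<beta> i = of_int s / of_nat t * var_x + const_x c \<and>
       \<alpha> i = (\<sigma> ^^ t) \<gamma> - \<gamma> \<and>
       (\<alpha> i \<in> range to_ac \<longrightarrow> \<gamma> \<in> range to_ac))"
    (is "_ \<longleftrightarrow> ?criterion")
proof -
  interpret shift_extension \<sigma>
    by standard fact
  have f: "f = (\<Sum>i = 1..m. pole j (\<alpha> i) (\<beta> i))"
    using assms(3) by (simp add: pole_def)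
  have incong: "\<beta> i - int_iterate \<sigma> n (\<beta> i') \<notin> \<int>" if "i \<in> {1..m}" "i' \<in> {1..m}" "i \<noteq> i'" for i i' n
  proof (cases "i < i'")
    case True
    then show ?thesis
      using that by (intro assms(5)) auto
  next
    case False
    then have "\<beta> i' - int_iterate \<sigma> n (\<beta> i) \<notin> \<int>" for n
      using that by (intro assms(5)) auto
    then show ?thesis
      by (rule int_iterate_swap)
  qed
  have residue_f: "residue j f b = (if b - \<beta> i \<in> \<int> then \<alpha> i else 0)"
    if "i \<in> {1..m}" "\<And>i'. i' \<in> {1..m} \<Longrightarrow> i' \<noteq> i \<Longrightarrow> b - \<beta> i' \<notin> \<int>" for b i
  proof -
    have "residue j f b = (\<Sum>i' = 1..m. if b - \<beta> i' \<in> \<int> then \<alpha> i' else 0)"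
      by (simp add: f residue_sum residue_pole \<open>j > 0\<close>)
    also have "\<dots> = (\<Sum>i'\<in>{i}. if b - \<beta> i' \<in> \<int> then \<alpha> i' else 0)"
      using that by (intro sum.mono_neutral_right) auto
    finally show ?thesis
      by simp
  qed
  show ?thesis
  proof
    assume ?criterion
    \<comment> \<open>Linearity of \<open>\<beta> i\<close> turns \<open>\<sigma> ^^ t\<close> into
      a translation of \<open>\<beta> i\<close> by \<open>s\<close>.\<close>
    then have "xy_summable \<sigma> (pole j (\<alpha> i) (\<beta> i))" if "i \<in> {1..m}" for i
      using that funpow_linear xy_summable_pole[OF inj_idom_hom_axioms] by metis
    then show "xy_summable \<sigma> f"
      unfolding f by (intro xy_summable_sum inj_idom_hom_axioms)
  next
    assume "xy_summable \<sigma> f"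
    then obtain g h where gh: "f = map_coeffs \<sigma> g - g + (shift_var h - h)"
      by (auto simp: xy_summable_def)
    show ?criterion
    proof
      fix i
      assume i: "i \<in> {1..m}"
      \<comment> \<open>The orbit of \<open>\<beta> i\<close> avoids the classes of all other poles,
        so only \<open>\<alpha> i\<close> contributes to residues along it.\<close>
      have other: "(\<sigma> ^^ k) (\<beta> i) - \<beta> i' \<notin> \<int>" "(\<tau> ^^ k) (\<beta> i) - \<beta> i' \<notin> \<int>"
        if "i' \<in> {1..m}" "i' \<noteq> i" for i' k
        using int_iterate_cases[OF incong[OF that(1) i that(2)], of k] diff_in_Ints_commute by blast+
      have residue_\<beta>: "residue j f (\<beta> i) = \<alpha> i"
        using residue_f[OF i, of "\<beta> i"] other[where k = 0] by simp
      obtain t \<gamma> where t: "t > 0" "(\<sigma> ^^ t) (\<beta> i) - \<beta> i \<in> \<int>" "\<alpha> i = (\<sigma> ^^ t) \<gamma> - \<gamma>"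
      proof (rule residue_periodic[OF \<open>j > 0\<close> gh, of "\<beta> i"])
        show "residue j f (\<beta> i) \<noteq> 0"
          using residue_\<beta> assms(4) i by simp
      qed (use residue_f[OF i] other residue_\<beta> in auto)
      obtain s c where "\<beta> i = of_int s / of_nat t * var_x + const_x c"
        using linear_if_periodic[OF shift_extension_axioms t(1,2)] by metis
      \<comment> \<open>Descent to \<open>F(x)\<close> applies if \<open>\<alpha> i\<close> lies
        there; otherwise \<open>\<gamma>\<close> itself serves.\<close>
      moreover obtain \<gamma>' where "\<alpha> i = (\<sigma> ^^ t) \<gamma>' - \<gamma>'" "\<alpha> i \<in> range to_ac \<longrightarrow> \<gamma>' \<in> range to_ac"
        using difference_descends[of t \<gamma>] t(3) by metis
      ultimately show "\<exists>(s::int) (t::nat) (c::'a) \<gamma>. t > 0 \<and>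
          \<beta> i = of_int s / of_nat t * var_x + const_x c \<and>
          \<alpha> i = (\<sigma> ^^ t) \<gamma> - \<gamma> \<and> (\<alpha> i \<in> range to_ac \<longrightarrow> \<gamma> \<in> range to_ac)"
        using t(1) by blast
    qed
  qed
qed

end
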